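(* Let $q$ be a prime power and $\ell\ge1$. Let $\mathcal{A}$ be the set of minimal representatives of the minimal cyclotomic sets of $\{0,1,\dots,q^{2\ell}-1\}$ with respect to $q^2$, and let $a_0=0<a_1<a_2<\cdots<a_{t-1}<a_t<q^{2\ell}-1$ be a sequence of consecutive elements of $\mathcal{A}$. Let $\Delta=\bigcup_{i=0}^{t-1}\mathfrak{I}_{a_i}\cup\{a_t\}$, let $\Delta''=\Delta\cup\mathfrak{I}_{a_t}$, and let $n=q^{2\ell-1}+1$. Assume that $(\mathcal{D}(\mathrm{Tr}_\ell,\Delta)^\perp)_{q^2}$ is not degenerate. Then $$\dim (\mathcal{D}(\mathrm{Tr}_\ell,\Delta)^\perp)_{q^2}=\dim(\mathrm{RS}(\mathrm{Tr}_\ell,\Delta'')^\perp)_{q^2}+1\ \ge\ n-\sum_{i=0}^{t}n_{a_i},$$ $$\mathrm{wt}\big((\mathcal{D}(\mathrm{Tr}_\ell,\Delta)^\perp)_{q^2}\big)\ \ge\ a_t+2.$$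
   Context: Cyclotomic sets. The set $\{0,1,\dots,q^{2\ell}-1\}$ is identified with $\{0\}\cup\mathbb{Z}/\langle q^{2\ell}-1\rangle$, the classes of $\mathbb{Z}/\langle q^{2\ell}-1\rangle$ being represented by $\{1,\dots,q^{2\ell}-1\}$ (so $0$ and $q^{2\ell}-1$ are distinct and $q^2\cdot 0=0$). The minimal cyclotomic set of $z$ with respect to $q^2$ is $\mathfrak{I}_z=\{q^{2i}\cdot z:i\ge0\}$, and $n_z=|\mathfrak{I}_z|$. A minimal representative is the least element of a minimal cyclotomic set. Points and codes. $\mathrm{Tr}_\ell(x)=x+x^q+x^{q^2}+\cdots+x^{q^{2\ell-1}}$, $Y_{\mathrm{Tr}_\ell}=\{\alpha\in\mathbb{F}_{q^{2\ell}}:\mathrm{Tr}_\ell(\alpha)=0\}$ (it has $q^{2\ell-1}$ elements), and $X_{\mathrm{Tr}_\ell}=\{(1,\alpha):\alpha\in Y_{\mathrm{Tr}_\ell}\}\cup\{(0,1)\}\subset\mathbb{F}_{q^{2\ell}}^2$. For $f\in\mathbb{F}_{q^{2\ell}}[x_0,x_1]$, $\mathrm{ev}_{\mathrm{Tr}_\ell}(f)=(f(P))_{P\in X_{\mathrm{Tr}_\ell}}\in\mathbb{F}_{q^{2\ell}}^n$ (with $0^0=1$). $\mathcal{D}(\mathrm{Tr}_\ell,\Delta)\subset\mathbb{F}_{q^{2\ell}}^n$ is the $\mathbb{F}_{q^{2\ell}}$-linear code generated by $\{\mathrm{ev}_{\mathrm{Tr}_\ell}(x_0x_1^\alpha):\alpha\in\Delta\setminus\{a_t\}\}\cup\{\mathrm{ev}_{\mathrm{Tr}_\ell}(x_1^{a_t})\}$.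 For $\Gamma\subset\{0,\dots,q^{2\ell}-1\}$, $\mathrm{RS}(\mathrm{Tr}_\ell,\Gamma)\subset\mathbb{F}_{q^{2\ell}}^{q^{2\ell-1}}$ is the $\mathbb{F}_{q^{2\ell}}$-linear code spanned by $(y^i)_{y\in Y_{\mathrm{Tr}_\ell}}$, $i\in\Gamma$. $\perp$ is the Euclidean dual over $\mathbb{F}_{q^{2\ell}}$, and for a code $C\subset\mathbb{F}_{q^{2\ell}}^m$, $C_{q^2}=C\cap\mathbb{F}_{q^2}^m$, an $\mathbb{F}_{q^2}$-linear code whose dimension is over $\mathbb{F}_{q^2}$. A code is degenerate if some coordinate is zero in all its codewords; $\mathrm{wt}(C)$ is the minimum Hamming distance of $C$. "Consecutive elements of $\mathcal{A}$" starting at $0$ means that $a_0,\dots,a_t$ are the $t+1$ smallest elements of $\mathcal{A}$. *)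

theory Defs
  imports
    "HOL-Analysis.Cartesian_Space"
    "HOL-Computational_Algebra.Polynomial"
    "HOL-Number_Theory.Prime_Powers"
begin

text \<open>The field with \<open>q^(2\<ell>)\<close> elements is a finite field type of that cardinality, and
  \<open>F^n\<close> is the type \<open>'a ^ 'n\<close>, so that dimension and span are the library's \<open>vec.dim\<close> and
  \<open>vec.span\<close>. The subfield with \<open>q^2\<close> elements is a second finite field type together with
  an embedding into the first.\<close>

definition field_embedding :: "('k::field \<Rightarrow> 'a::field) \<Rightarrow> bool" where
  "field_embedding \<phi> \<longleftrightarrow>
     \<phi> 1 = 1 \<and> (\<forall>x y. \<phi> (x + y) = \<phi> x + \<phi> y) \<and> (\<forall>x y. \<phi> (x * y) = \<phi> x * \<phi> y)"

text \<open>The representative of \<open>m\<close> in \<open>{0, \<dots>, q^(2\<ell>) - 1}\<close>: \<open>0\<close> represents only itself, and a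
  positive \<open>m\<close> is represented by the element of \<open>{1, \<dots>, q^(2\<ell>) - 1}\<close> congruent to it modulo
  \<open>q^(2\<ell>) - 1\<close>.\<close>

definition exp_rep :: "nat \<Rightarrow> nat \<Rightarrow> nat \<Rightarrow> nat" where
  "exp_rep q l m = (if m = 0 then 0 else (m - 1) mod (q ^ (2 * l) - 1) + 1)"

definition cyclotomic_set :: "nat \<Rightarrow> nat \<Rightarrow> nat \<Rightarrow> nat set" where
  "cyclotomic_set q l z = {exp_rep q l ((q\<^sup>2) ^ i * z) | i. True}"

definition min_representatives :: "nat \<Rightarrow> nat \<Rightarrow> nat set" where
  "min_representatives q l = {Min (cyclotomic_set q l z) | z. z \<le> q ^ (2 * l) - 1}"

definition Tr :: "nat \<Rightarrow> nat \<Rightarrow> 'a::field \<Rightarrow> 'a" where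
  "Tr q l x = (\<Sum>j<2 * l. x ^ (q ^ j))"

definition Y_Tr :: "nat \<Rightarrow> nat \<Rightarrow> 'a::field set" where
  "Y_Tr q l = {\<alpha>. Tr q l \<alpha> = 0}"

definition X_Tr :: "nat \<Rightarrow> nat \<Rightarrow> ('a::field \<times> 'a) set" where
  "X_Tr q l = {(1, \<alpha>) | \<alpha>. \<alpha> \<in> Y_Tr q l} \<union> {(0, 1)}"

text \<open>Polynomials in \<open>x\<^sub>0\<close>, \<open>x\<^sub>1\<close> are polynomials in \<open>x\<^sub>1\<close> whose coefficients are polynomials
  in \<open>x\<^sub>0\<close>. The coordinates of \<open>F^n\<close> correspond to the points through an enumeration \<open>P\<close>.\<close>

definition x0 :: "'a::field poly poly" where "x0 = [:[:0, 1:]:]"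

definition x1 :: "'a::field poly poly" where "x1 = [:0, 1:]"

definition poly2 :: "'a::field poly poly \<Rightarrow> 'a \<times> 'a \<Rightarrow> 'a" where
  "poly2 f p = poly (poly f [:snd p:]) (fst p)"

definition ev :: "('n \<Rightarrow> 'a::field \<times> 'a) \<Rightarrow> 'a poly poly \<Rightarrow> 'a ^ 'n" where
  "ev P f = (\<chi> i. poly2 f (P i))"

definition D_code :: "('n::finite \<Rightarrow> 'a::field \<times> 'a) \<Rightarrow> nat set \<Rightarrow> nat \<Rightarrow> ('a ^ 'n) set" where
  "D_code P \<Delta> a\<^sub>t = vec.span ({ev P (x0 * x1 ^ \<alpha>) | \<alpha>. \<alpha> \<in> \<Delta> - {a\<^sub>t}} \<union> {ev P (x1 ^ a\<^sub>t)})"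

definition RS_code :: "('m::finite \<Rightarrow> 'a::field) \<Rightarrow> nat set \<Rightarrow> ('a ^ 'm) set" where
  "RS_code Y \<Gamma> = vec.span {(\<chi> j. Y j ^ i) | i. i \<in> \<Gamma>}"

definition dual_code :: "('a::field ^ 'n::finite) set \<Rightarrow> ('a ^ 'n) set" where
  "dual_code C = {v. \<forall>c\<in>C. (\<Sum>i\<in>UNIV. v $ i * c $ i) = 0}"

text \<open>\<open>C \<inter> K^n\<close> for the subfield \<open>K\<close> given by the embedding \<open>\<phi>\<close>, with the words written over
  \<open>K\<close>, so that \<open>vec.dim\<close> of it is the dimension over \<open>K\<close>.\<close>

definition subfield_subcode :: "('k::field \<Rightarrow> 'a::field) \<Rightarrow> ('a ^ 'n) set \<Rightarrow> ('k ^ 'n) set" where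
  "subfield_subcode \<phi> C = {v. (\<chi> i. \<phi> (v $ i)) \<in> C}"

definition degenerate :: "('k::field ^ 'n) set \<Rightarrow> bool" where
  "degenerate C \<longleftrightarrow> (\<exists>i. \<forall>c\<in>C. c $ i = 0)"

definition hamming_dist :: "'k ^ 'n::finite \<Rightarrow> 'k ^ 'n \<Rightarrow> nat" where
  "hamming_dist u v = card {i. u $ i \<noteq> v $ i}"

text \<open>For a code with at most one word this is \<open>Inf {} = 0\<close>; a nondegenerate linear code has at
  least two words.\<close>

definition min_dist :: "('k ^ 'n::finite) set \<Rightarrow> nat" where
  "min_dist C = Inf {hamming_dist u v | u v. u \<in> C \<and> v \<in> C \<and> u \<noteq> v}"

end

theory Submission
  imports Defs "HOL-Number_Theory.Residues"
begin

text \<open>Write a word of length \<open>n\<close> as \<open>(v, s)\<close> with \<open>s\<close> the coordinate of the point \<open>(0, 1)\<close>, and let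
  \<open>S\<^sub>x(v) = \<Sum>\<^sub>y v\<^sub>y y\<^sup>x\<close>. Then \<open>(v, s)\<close> lies in the dual of \<open>D_code\<close> iff \<open>S\<^sub>x(v) = 0\<close> for the
  \<open>x \<in> \<Delta>\<close> other than \<open>a\<^sub>t\<close>, and \<open>S\<^bsub>a\<^sub>t\<^esub>(v) + s = 0\<close>. For \<open>v\<close> over the subfield the Frobenius map
  \<open>z \<mapsto> z^(q\<^sup>2)\<close> sends \<open>S\<^sub>x(v)\<close> to \<open>S\<^bsub>q\<^sup>2x\<^esub>(v)\<close>, so the vanishing of \<open>S\<^sub>x(v)\<close> depends only on the
  cyclotomic set of \<open>x\<close>. Hence the words with \<open>s = 0\<close> form the dual RS subfield subcode, which has
  codimension one by nondegeneracy. As \<open>S\<^sub>x\<close> takes at most \<open>q^(2n\<^sub>x)\<close> values, counting the common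
  kernel of the \<open>S\<^bsub>a\<^sub>i\<^esub>\<close> bounds the dimension. Finally all \<open>S\<^sub>x\<close> with \<open>x < a\<^sub>t\<close> vanish, and summing a
  polynomial of degree at most \<open>a\<^sub>t\<close> that vanishes on (almost) the whole support bounds the weight.\<close>

section \<open>Finite fields and counting\<close>

text \<open>Multiplication by a nonzero \<open>x\<close> permutes the nonzero elements; comparing
  the products of all of them gives \<open>x ^ (CARD('a) - 1) = 1\<close>.\<close>

lemma finite_field_power_CARD:
  fixes x :: "'a::{field, finite}"
  shows "x ^ CARD('a) = x"
proof (cases "x = 0")
  case False
  let ?U = "UNIV - {0 :: 'a}"
  have "(\<Prod>y\<in>?U. y) = (\<Prod>y\<in>?U. x * y)"
    by (rule prod.reindex_bij_witness[of _ "(*) x" "(*) (inverse x)"]) (use False in \<open>auto simp: field_simps\<close>)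
  also have "\<dots> = x ^ card ?U * (\<Prod>y\<in>?U. y)"
    by (simp add: prod.distrib)
  finally have "x ^ card ?U = 1"
    by simp
  then have "x ^ Suc (card ?U) = x"
    by (simp only: power_Suc mult_1_right)
  moreover have "Suc (card ?U) = CARD('a)"
    by (rule card_Suc_Diff1) auto
  ultimately show ?thesis
    by metis
qed simp

lemma CHAR_eq_prime_if_CARD:
  assumes "CARD('a::{field, finite}) = p ^ m" and "prime p"
  shows "CHAR('a) = p"
proof -
  have "CHAR('a) > 0"
    by (rule finite_imp_CHAR_pos) simp
  then have "prime CHAR('a)"
    by (rule prime_CHAR_semidom)
  moreover have "CHAR('a) dvd p ^ m"
    using CHAR_dvd_CARD[where 'a='a] assms(1) by simp
  ultimately show ?thesis
    using assms(2) prime_dvd_power primes_dvd_imp_eq by blast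
qed

text \<open>\<open>q ^ j\<close> is a power of the characteristic.\<close>

lemma Frobenius_sum:
  fixes f :: "'b \<Rightarrow> 'a::{field, finite}"
  assumes "primepow q" and "CARD('a) = q ^ m"
  shows "(\<Sum>i\<in>A. f i) ^ (q ^ j) = (\<Sum>i\<in>A. f i ^ (q ^ j))"
proof -
  obtain p k where p: "prime p" "q = p ^ k"
    using assms(1) by (auto simp: primepow_def)
  then have "CARD('a) = p ^ (k * m)"
    using assms(2) by (simp add: power_mult)
  then have "CHAR('a) = p"
    using CHAR_eq_prime_if_CARD p(1) by blast
  then show ?thesis
    using freshmans_dream_sum'[where 'a='a, of "q ^ j" "k * j" f A] p
    by (simp add: power_mult)
qed

lemma Frobenius_inj:
  fixes x y :: "'a::{field, finite}"
  assumes "primepow q" and "CARD('a) = q ^ m" and "x ^ (q ^ j) = y ^ (q ^ j)"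
  shows "x = y"
proof -
  \<comment> \<open>A sum over \<open>bool\<close> has two terms, which turns
    \<open>Frobenius_sum\<close> into additivity.\<close>
  have "x ^ (q ^ j) = (x - y) ^ (q ^ j) + y ^ (q ^ j)"
    using Frobenius_sum[OF assms(1,2), of "\<lambda>b. if b then x - y else y" UNIV j]
    by (simp add: UNIV_bool)
  then have "(x - y) ^ (q ^ j) = 0"
    using assms(3) by simp
  then show ?thesis
    by simp
qed

lemma card_power_fixed_le:
  fixes n :: nat
  assumes "n > 1"
  shows "card {x::'a::idom. x ^ n = x} \<le> n"
proof -
  let ?p = "Polynomial.monom 1 n - [:0, 1:] :: 'a poly"
  have "degree ?p = n"
    using assms by (subst diff_conv_add_uminus, subst degree_add_eq_left) (auto simp: degree_monom_eq)
  moreover from this have "?p \<noteq> 0"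
    using assms by (metis degree_0 not_less_zero)
  ultimately have "card {x. poly ?p x = 0} \<le> n"
    using card_poly_roots_bound[of ?p] by simp
  then show ?thesis
    by (simp add: poly_monom)
qed

text \<open>Subtracting one point of a fibre maps that fibre injectively into the kernel.\<close>

lemma card_le_card_kernel_times_image:
  fixes f :: "'v::{ab_group_add, finite} \<Rightarrow> 'b::ab_group_add"
  assumes A: "\<And>x y. x \<in> A \<Longrightarrow> y \<in> A \<Longrightarrow> x - y \<in> A"
    and f: "\<And>x y. f (x + y) = f x + f y"
  shows "card A \<le> card {x \<in> A. f x = 0} * card (f ` A)"
proof -
  have f_diff: "f (x - y) = f x - f y" for x y
    using f[of "x - y" y] by (simp add: algebra_simps)
  have fibre: "card {x \<in> A. f x = b} \<le> card {x \<in> A. f x = 0}" if b: "b \<in> f ` A" for b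
  proof -
    obtain z where z: "z \<in> A" "b = f z"
      using b by blast
    show ?thesis
      by (rule card_inj_on_le[of "\<lambda>x. x - z"]) (use A z in \<open>auto simp: f_diff inj_on_def\<close>)
  qed
  have "A = (\<Union>b\<in>f ` A. {x \<in> A. f x = b})"
    by auto
  then have "card A \<le> (\<Sum>b\<in>f ` A. card {x \<in> A. f x = b})"
    using card_UN_le[of "f ` A" "\<lambda>b. {x \<in> A. f x = b}"] by simp
  also have "\<dots> \<le> (\<Sum>b\<in>f ` A. card {x \<in> A. f x = 0})"
    by (rule sum_mono) (rule fibre)
  finally show ?thesis
    by (simp add: mult.commute)
qed

text \<open>Intersecting with one more kernel shrinks the set by at most the factor
  \<open>B i\<close>. Only additivity enters, so the count serves both the syndromes and the
  trace.\<close>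

lemma CARD_le_card_common_kernel:
  fixes f :: "'i \<Rightarrow> 'v::{ab_group_add, finite} \<Rightarrow> 'b::ab_group_add"
  assumes "finite I"
    and f: "\<And>i x y. f i (x + y) = f i x + f i y"
    and B: "\<And>i. i \<in> I \<Longrightarrow> card (range (f i)) \<le> B i"
  shows "CARD('v) \<le> card {x. \<forall>i\<in>I. f i x = 0} * (\<Prod>i\<in>I. B i)"
  using assms(1) B
proof (induction I)
  case (insert i I)
  let ?A = "{x. \<forall>i\<in>I. f i x = 0}"
  have f_diff: "f i (x - y) = f i x - f i y" for i x y
    using f[of i "x - y" y] by (simp add: algebra_simps)
  have "card ?A \<le> card {x \<in> ?A. f i x = 0} * card (f i ` ?A)"
    by (rule card_le_card_kernel_times_image) (auto simp: f f_diff)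
  also have "\<dots> \<le> card {x \<in> ?A. f i x = 0} * B i"
    using card_mono[of "range (f i)" "f i ` ?A"] insert.prems[of i] by force
  also have "{x \<in> ?A. f i x = 0} = {x. \<forall>i\<in>insert i I. f i x = 0}"
    by auto
  finally have step: "card ?A \<le> card {x. \<forall>i\<in>insert i I. f i x = 0} * B i" .
  have "CARD('v) \<le> card ?A * (\<Prod>i\<in>I. B i)"
    using insert by simp
  also have "\<dots> \<le> card {x. \<forall>i\<in>insert i I. f i x = 0} * B i * (\<Prod>i\<in>I. B i)"
    using step by simp
  finally show ?case
    using insert.hyps by (simp add: mult.assoc)
qed simp

text \<open>Lets dimensions be compared by counting words. Each new basis vector contributes one
  free coefficient, so the span grows by the factor \<open>CARD('k)\<close>.\<close>

lemma card_subspace_vec: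
  fixes S :: "('k::{field, finite} ^ 'n::finite) set"
  assumes "vec.subspace S"
  shows "card S = CARD('k) ^ vec.dim S"
proof -
  obtain B where B: "B \<subseteq> S" "vec.independent B" "S \<subseteq> vec.span B" "card B = vec.dim S"
    using vec.basis_exists by blast
  have "card (vec.span B) = CARD('k) ^ card B"
    using finite[of B] B(2)
  proof (induction B)
    case (insert b B)
    have ind: "vec.independent B" "b \<notin> vec.span B"
      using insert.prems insert.hyps by (simp_all add: vec.independent_insert)
    let ?g = "\<lambda>(c, x). c *s b + x"
    have "inj_on ?g (UNIV \<times> vec.span B)"
    proof (rule inj_onI, clarsimp)
      fix c d x y
      assume x: "x \<in> vec.span B" "y \<in> vec.span B" and eq: "c *s b + x = d *s b + y"
      then have "(c - d) *s b = y - x"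
        by (simp add: algebra_simps vec.scale_left_diff_distrib)
      then have "(c - d) *s b \<in> vec.span B"
        using x by (simp add: vec.span_diff)
      then have "c = d"
        using ind(2) vec.span_scale[of "(c - d) *s b" B "inverse (c - d)"]
        by (cases "c = d") simp_all
      then show "c = d \<and> x = y"
        using eq by simp
    qed
    moreover have "?g ` (UNIV \<times> vec.span B) = vec.span (insert b B)"
    proof (intro equalityI subsetI)
      fix x assume "x \<in> vec.span (insert b B)"
      then obtain c where "x - c *s b \<in> vec.span B"
        by (auto simp: vec.span_breakdown_eq)
      then show "x \<in> ?g ` (UNIV \<times> vec.span B)"
        by (intro image_eqI[of _ _ "(c, x - c *s b)"]) simp_all
    next
      fix x assume "x \<in> ?g ` (UNIV \<times> vec.span B)"
      then obtain c y where "y \<in> vec.span B" "x = c *s b + y"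
        by auto
      then show "x \<in> vec.span (insert b B)"
        unfolding vec.span_breakdown_eq by (intro exI[of _ c]) simp
    qed
    ultimately have "card (vec.span (insert b B)) = card ((UNIV :: 'k set) \<times> vec.span B)"
      by (metis card_image)
    then show ?case
      using insert ind by (simp add: card_cartesian_product)
  qed simp
  moreover have "S = vec.span B"
    using B(1,3) assms vec.span_minimal by blast
  ultimately show ?thesis
    using B(4) by simp
qed

section \<open>Duals of spans\<close>

text \<open>The words orthogonal to a fixed \<open>v\<close> form a subspace, so testing generators
  suffices.\<close>

lemma dual_code_span:
  fixes S :: "('a::field ^ 'n::finite) set"
  shows "dual_code (vec.span S) = {v. \<forall>c\<in>S. (\<Sum>i\<in>UNIV. v $ i * c $ i) = 0}"
proof -
  have "vec.subspace {c. (\<Sum>i\<in>UNIV. v $ i * c $ i) = 0}" for v :: "'a ^ 'n"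
    by (auto simp: vec.subspace_def algebra_simps sum.distrib simp flip: sum_distrib_left)
  then have "vec.span S \<subseteq> {c. (\<Sum>i\<in>UNIV. v $ i * c $ i) = 0}"
    if "S \<subseteq> {c. (\<Sum>i\<in>UNIV. v $ i * c $ i) = 0}" for v :: "'a ^ 'n"
    using that by (intro vec.span_minimal)
  then have "(\<forall>c\<in>vec.span S. (\<Sum>i\<in>UNIV. v $ i * c $ i) = 0) \<longleftrightarrow>
      (\<forall>c\<in>S. (\<Sum>i\<in>UNIV. v $ i * c $ i) = 0)" for v :: "'a ^ 'n"
    using vec.span_superset[of S] unfolding subset_iff mem_Collect_eq by metis
  then show ?thesis
    by (simp add: dual_code_def)
qed

text \<open>The Reed-Solomon parity check with exponent \<open>x\<close>. Words are written over the
  subfield, so their entries pass through \<open>\<phi>\<close> first.\<close>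

definition syndrome :: "('k::field \<Rightarrow> 'a::field) \<Rightarrow> ('m::finite \<Rightarrow> 'a) \<Rightarrow> nat \<Rightarrow> 'k ^ 'm \<Rightarrow> 'a" where
  "syndrome \<phi> Y x v = (\<Sum>j\<in>UNIV. \<phi> (v $ j) * Y j ^ x)"

lemma subfield_subcode_dual_RS_code:
  "subfield_subcode \<phi> (dual_code (RS_code Y \<Gamma>)) = {v. \<forall>x\<in>\<Gamma>. syndrome \<phi> Y x v = 0}"
  unfolding subfield_subcode_def RS_code_def dual_code_span syndrome_def by fastforce

text \<open>Separates the affine points, reached through \<open>\<sigma>\<close>, from the extra
  point at \<open>\<omega>\<close>; the first coordinates 1 and 0 keep them apart.\<close>

lemma bij_betw_X_Tr_cases:
  fixes P :: "'n::finite \<Rightarrow> 'a::field \<times> 'a" and Y :: "'m::finite \<Rightarrow> 'a"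
  assumes P: "bij_betw P UNIV (X_Tr q l)" and Y: "bij_betw Y UNIV (Y_Tr q l)"
  obtains \<sigma> \<omega> where "inj \<sigma>" and "\<omega> \<notin> range \<sigma>" and "UNIV = insert \<omega> (range \<sigma>)"
    and "\<And>j. P (\<sigma> j) = (1, Y j)" and "P \<omega> = (0, 1)"
proof
  have P': "inj P" "range P = X_Tr q l" and Y': "inj Y" "range Y = Y_Tr q l"
    using P Y by (auto simp: bij_betw_def)
  let ?\<sigma> = "\<lambda>j. inv_into UNIV P (1, Y j)" and ?i = "inv_into UNIV P (0, 1)"
  have "(1, Y j) \<in> range P" "(0, 1) \<in> range P" for j
    using Y'(2) by (auto simp: P'(2) X_Tr_def)
  then show P_eq: "P (?\<sigma> j) = (1, Y j)" "P ?i = (0, 1)" for j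
    by (simp_all only: f_inv_into_f)
  show "inj ?\<sigma>"
  proof (rule injI)
    fix j j' assume "?\<sigma> j = ?\<sigma> j'"
    then have "P (?\<sigma> j) = P (?\<sigma> j')"
      by (rule arg_cong)
    then show "j = j'"
      unfolding P_eq using Y'(1) by (simp add: inj_eq)
  qed
  show "?i \<notin> range ?\<sigma>"
  proof
    assume "?i \<in> range ?\<sigma>"
    then obtain j where "?i = ?\<sigma> j"
      by blast
    then have "P ?i = P (?\<sigma> j)"
      by (rule arg_cong)
    then show False
      unfolding P_eq by simp
  qed
  have "i \<in> insert ?i (range ?\<sigma>)" for i
  proof -
    have "P i \<in> {(1, \<alpha>) | \<alpha>. \<alpha> \<in> range Y} \<union> {(0, 1)}"
      using P'(2) unfolding Y'(2) X_Tr_def by blast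
    then have "P i = P ?i \<or> (\<exists>j. P i = P (?\<sigma> j))"
      unfolding P_eq by blast
    then show ?thesis
      unfolding inj_eq[OF P'(1)] by blast
  qed
  then show "UNIV = insert ?i (range ?\<sigma>)"
    by blast
qed

text \<open>The factor \<open>x0\<close> vanishes at \<open>(0, 1)\<close>, whereas
  \<open>x1 ^ b\<close> is 1 there, so the coordinate \<open>\<omega>\<close> enters exactly one
  check.\<close>

lemma subfield_subcode_dual_D_code:
  fixes \<phi> :: "'k::field \<Rightarrow> 'a::field" and \<sigma> :: "'m::finite \<Rightarrow> 'n::finite"
  assumes "inj \<sigma>" and "\<omega> \<notin> range \<sigma>" and "UNIV = insert \<omega> (range \<sigma>)"
    and P: "\<And>j. P (\<sigma> j) = (1, Y j)" "P \<omega> = (0, 1)"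
  shows "subfield_subcode \<phi> (dual_code (D_code P \<Delta> b)) =
    {v. (\<forall>x\<in>\<Delta> - {b}. syndrome \<phi> Y x (\<chi> j. v $ \<sigma> j) = 0) \<and>
        syndrome \<phi> Y b (\<chi> j. v $ \<sigma> j) + \<phi> (v $ \<omega>) = 0}"
proof -
  have sum_split: "(\<Sum>i\<in>UNIV. f i) = f \<omega> + (\<Sum>j\<in>UNIV. f (\<sigma> j))" for f :: "'n \<Rightarrow> 'a"
    by (subst assms(3), subst sum.insert) (use assms(1,2) in \<open>auto simp: sum.reindex\<close>)
  have ev_x: "ev P (x0 * x1 ^ x) $ i = fst (P i) * snd (P i) ^ x"
    "ev P (x1 ^ x) $ i = snd (P i) ^ x" for x i
    by (simp_all add: ev_def poly2_def x0_def x1_def)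
  show ?thesis
    unfolding subfield_subcode_def D_code_def dual_code_span
    by (auto simp: sum_split ev_x P syndrome_def add.commute)
qed

section \<open>Weight bound by polynomials vanishing on the support\<close>

lemma sum_poly_eq_syndrome:
  assumes "degree p \<le> b" and "\<And>x. x < b \<Longrightarrow> syndrome \<phi> Y x w = 0"
  shows "(\<Sum>j\<in>UNIV. \<phi> (w $ j) * poly p (Y j)) = poly.coeff p b * syndrome \<phi> Y b w"
proof -
  have "poly p y = (\<Sum>i\<le>b. poly.coeff p i * y ^ i)" for y
    unfolding poly_altdef
    by (rule sum.mono_neutral_left) (use assms(1) in \<open>auto simp: coeff_eq_0\<close>)
  then have "(\<Sum>j\<in>UNIV. \<phi> (w $ j) * poly p (Y j)) =
      (\<Sum>j\<in>UNIV. \<Sum>i\<le>b. poly.coeff p i * (\<phi> (w $ j) * Y j ^ i))"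
    by (simp add: sum_distrib_left mult.left_commute)
  also have "\<dots> = (\<Sum>i\<le>b. poly.coeff p i * syndrome \<phi> Y i w)"
    by (subst sum.swap) (simp add: syndrome_def sum_distrib_left)
  also have "\<dots> = (\<Sum>i\<in>{b}. poly.coeff p i * syndrome \<phi> Y i w)"
    by (rule sum.mono_neutral_right) (use assms(2) in auto)
  finally show ?thesis
    by simp
qed

text \<open>A lighter word leaves room for a polynomial of degree at most \<open>b\<close>. If
  \<open>s\<close> is nonzero, the support has at most \<open>b\<close> points, and padding with a
  monomial reaches degree exactly \<open>b\<close>; this forces the syndrome at \<open>b\<close>,
  hence \<open>s\<close>, to vanish. If \<open>s = 0\<close>, the syndrome at \<open>b\<close>
  vanishes as well and one more support point is affordable.\<close>

lemma weight_lower_bound: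
  fixes \<phi> :: "'k::field \<Rightarrow> 'a::field"
  assumes "inj Y" and \<phi>: "\<And>c. \<phi> c = 0 \<longleftrightarrow> c = 0"
    and low: "\<And>x. x < b \<Longrightarrow> syndrome \<phi> Y x w = 0"
    and top: "syndrome \<phi> Y b w + \<phi> s = 0"
    and "w \<noteq> 0 \<or> s \<noteq> 0"
  shows "b + 2 \<le> card {j. w $ j \<noteq> 0} + (if s = 0 then 0 else 1)"
proof (rule ccontr)
  let ?S = "{j. w $ j \<noteq> 0}"
  assume small: "\<not> ?thesis"
  show False
  proof (cases "s = 0")
    case False
    \<comment> \<open>a monic polynomial of degree \<open>b\<close> vanishing on the support\<close>
    define p where "p = (\<Prod>j\<in>?S. [:- Y j, 1:]) * Polynomial.monom 1 (b - card ?S)"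
    have "lead_coeff p = 1"
      unfolding p_def lead_coeff_mult lead_coeff_prod
      by (simp add: degree_monom_eq)
    moreover have "degree p = b"
      using small False
      by (simp add: p_def degree_mult_eq degree_monom_eq degree_prod_sum_eq)
    ultimately have "syndrome \<phi> Y b w = (\<Sum>j\<in>UNIV. \<phi> (w $ j) * poly p (Y j))"
      using sum_poly_eq_syndrome[of p b \<phi> Y w] low by simp
    also have "\<dots> = 0"
      by (rule sum.neutral) (auto simp: p_def poly_prod \<phi>)
    finally show False
      using top False \<phi> by simp
  next
    case True
    then obtain k where k: "k \<in> ?S"
      using assms(5) by (auto simp: vec_eq_iff)
    \<comment> \<open>Omitting \<open>k\<close> keeps the degree at most \<open>b\<close> and leaves
      a single term in the sum, nonzero because \<open>Y\<close> is injective.\<close>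
    define p where "p = (\<Prod>j\<in>?S - {k}. [:- Y j, 1:])"
    have "degree p = card ?S - 1"
      using k by (simp add: p_def degree_prod_sum_eq)
    then have "(\<Sum>j\<in>UNIV. \<phi> (w $ j) * poly p (Y j)) = poly.coeff p b * syndrome \<phi> Y b w"
      using small True by (intro sum_poly_eq_syndrome low) auto
    also have "\<dots> = 0"
      using top True \<phi>[of 0] by simp
    also have "(\<Sum>j\<in>UNIV. \<phi> (w $ j) * poly p (Y j)) = (\<Sum>j\<in>{k}. \<phi> (w $ j) * poly p (Y j))"
      by (rule sum.mono_neutral_right) (auto simp: p_def poly_prod \<phi>)
    finally show False
      using k \<open>inj Y\<close> by (auto simp: p_def poly_prod \<phi> inj_eq)
  qed
qed

lemma weight_eq_restrict:
  fixes v :: "'k::zero ^ 'n::finite" and \<sigma> :: "'m::finite \<Rightarrow> 'n"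
  assumes \<sigma>: "inj \<sigma>" "\<omega> \<notin> range \<sigma>" "UNIV = insert \<omega> (range \<sigma>)"
  shows "card {i. v $ i \<noteq> 0} =
    card {j. (\<chi> j. v $ \<sigma> j) $ j \<noteq> 0} + (if v $ \<omega> = 0 then 0 else 1)"
proof -
  have "i = \<omega> \<or> (\<exists>j. i = \<sigma> j)" for i
    using \<sigma>(3) by blast
  then have "{i. v $ i \<noteq> 0} =
      \<sigma> ` {j. v $ \<sigma> j \<noteq> 0} \<union> (if v $ \<omega> = 0 then {} else {\<omega>})"
    by (auto split: if_splits) (metis (mono_tags, lifting) imageI mem_Collect_eq)+
  moreover have "card (\<sigma> ` {j. v $ \<sigma> j \<noteq> 0}) = card {j. v $ \<sigma> j \<noteq> 0}"
    using \<sigma>(1) by (intro card_image) (auto simp: inj_on_def)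
  moreover have "\<omega> \<notin> \<sigma> ` {j. v $ \<sigma> j \<noteq> 0}"
    using \<sigma>(2) by blast
  ultimately show ?thesis
    by simp
qed

section \<open>Syndromes and cyclotomic sets\<close>

locale finite_field_extension =
  fixes q l :: nat and \<phi> :: "'k::{field, finite} \<Rightarrow> 'a::{field, finite}"
  assumes primepow_q: "primepow q" and l_ge_1: "l \<ge> 1"
    and card_a: "CARD('a) = q ^ (2 * l)" and card_k: "CARD('k) = q\<^sup>2"
    and embedding: "field_embedding \<phi>"
begin

lemma q_gt_1: "q > 1"
  using primepow_gt_Suc_0[OF primepow_q] by simp

lemma Q_gt_1: "q\<^sup>2 > 1"
  using one_less_power[OF q_gt_1, of 2] by simp

lemma card_a_gt_1: "q ^ (2 * l) > 1"
  using one_less_power[OF q_gt_1, of "2 * l"] l_ge_1 by simp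

lemma \<phi>_add: "\<phi> (x + y) = \<phi> x + \<phi> y"
  and \<phi>_mult: "\<phi> (x * y) = \<phi> x * \<phi> y"
  and \<phi>_1: "\<phi> 1 = 1"
  using embedding by (auto simp: field_embedding_def)

lemma \<phi>_eq_0_iff: "\<phi> x = 0 \<longleftrightarrow> x = 0"
proof
  show "\<phi> x = 0" if "x = 0"
    using \<phi>_add[of 0 0] that by (metis add_0_right add_left_cancel)
  show "x = 0" if "\<phi> x = 0"
    using \<phi>_mult[of x "inverse x"] \<phi>_1 that by (cases "x = 0") simp_all
qed

lemma \<phi>_diff: "\<phi> (x - y) = \<phi> x - \<phi> y"
  using \<phi>_add[of "x - y" y] by (simp add: algebra_simps)

lemma \<phi>_power: "\<phi> (x ^ m) = \<phi> x ^ m"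
  by (induction m) (simp_all add: \<phi>_1 \<phi>_mult)

text \<open>The subfield has \<open>q ^ 2\<close> elements, so its image consists of roots of
  \<open>z ^ (q ^ 2) = z\<close>.\<close>

lemma \<phi>_fixed: "\<phi> x ^ ((q\<^sup>2) ^ i) = \<phi> x"
proof (induction i)
  case (Suc i)
  have "\<phi> x ^ q\<^sup>2 = \<phi> x"
    using finite_field_power_CARD[of x] by (metis \<phi>_power card_k)
  then show ?case
    using Suc by (simp add: power_mult)
qed simp

lemma syndrome_add: "syndrome \<phi> Y x (v + w) = syndrome \<phi> Y x v + syndrome \<phi> Y x w"
  by (simp add: syndrome_def \<phi>_add algebra_simps sum.distrib)

lemma syndrome_diff: "syndrome \<phi> Y x (v - w) = syndrome \<phi> Y x v - syndrome \<phi> Y x w"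
  by (simp add: syndrome_def \<phi>_diff algebra_simps sum_subtractf)

lemma syndrome_scale: "syndrome \<phi> Y x (c *s v) = \<phi> c * syndrome \<phi> Y x v"
  by (simp add: syndrome_def \<phi>_mult sum_distrib_left mult.assoc)

lemma syndrome_zero: "syndrome \<phi> Y x 0 = 0"
  using syndrome_diff[of Y x 0 0] by simp

lemma subspace_syndromes: "vec.subspace {v. \<forall>x\<in>\<Gamma>. syndrome \<phi> Y x v = 0}"
  by (simp add: vec.subspace_def syndrome_add syndrome_scale syndrome_zero)

text \<open>The Frobenius power is additive and fixes the embedded entries, so it acts on the
  evaluation points alone.\<close>

lemma syndrome_power:
  "syndrome \<phi> Y x v ^ ((q\<^sup>2) ^ i) = syndrome \<phi> Y ((q\<^sup>2) ^ i * x) v"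
proof -
  have "syndrome \<phi> Y x v ^ (q ^ (2 * i)) = (\<Sum>j\<in>UNIV. (\<phi> (v $ j) * Y j ^ x) ^ (q ^ (2 * i)))"
    unfolding syndrome_def by (rule Frobenius_sum[OF primepow_q card_a])
  then show ?thesis
    by (simp add: syndrome_def power_mult power_mult_distrib \<phi>_fixed)
       (simp add: mult.commute flip: power_mult)
qed

text \<open>Nonzero elements satisfy \<open>y ^ N = 1\<close> for
  \<open>N = q ^ (2 * l) - 1\<close>. Keeping the exponents 0 and \<open>N\<close> apart makes
  \<open>y = 0\<close> work too: \<open>0 ^ 0 = 1\<close> but \<open>0 ^ N = 0\<close>.\<close>

lemma power_exp_rep: "y ^ exp_rep q l m = y ^ m" for y :: 'a
proof (cases "m = 0 \<or> y = 0")
  case True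
  then show ?thesis
    by (auto simp: exp_rep_def)
next
  case False
  define N where "N = q ^ (2 * l) - 1"
  have "Suc N = CARD('a)"
    using card_a_gt_1 by (simp add: N_def card_a)
  then have "y * y ^ N = y"
    using finite_field_power_CARD[of y] by (metis power_Suc)
  then have y: "y ^ N = 1"
    using False by simp
  have "y ^ m = y ^ ((m - 1) div N * N + (m - 1) mod N + 1)"
    using False by simp
  also have "\<dots> = (y ^ N) ^ ((m - 1) div N) * y ^ ((m - 1) mod N + 1)"
    unfolding power_add power_mult[symmetric] by (simp add: mult.commute mult.left_commute)
  finally show ?thesis
    using False unfolding y by (simp add: exp_rep_def N_def)
qed

lemma syndrome_exp_rep: "syndrome \<phi> Y (exp_rep q l m) v = syndrome \<phi> Y m v"
  by (simp add: syndrome_def power_exp_rep)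

text \<open>The syndrome at \<open>z\<close> is a Frobenius power of the one at \<open>x\<close>,
  and a field has no nilpotents.\<close>

lemma syndrome_cyclotomic_set:
  assumes "z \<in> cyclotomic_set q l x"
  shows "syndrome \<phi> Y z v = 0 \<longleftrightarrow> syndrome \<phi> Y x v = 0"
proof -
  obtain i where "z = exp_rep q l ((q\<^sup>2) ^ i * x)"
    using assms by (auto simp: cyclotomic_set_def)
  then have "syndrome \<phi> Y z v = syndrome \<phi> Y x v ^ ((q\<^sup>2) ^ i)"
    by (simp add: syndrome_exp_rep syndrome_power)
  then show ?thesis
    using q_gt_1 by simp
qed

lemma exp_rep_le: "exp_rep q l m \<le> q ^ (2 * l) - 1"
proof -
  have "(m - 1) mod (q ^ (2 * l) - 1) < q ^ (2 * l) - 1"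
    using card_a_gt_1 by simp
  then show ?thesis
    by (simp add: exp_rep_def)
qed

lemma cyclotomic_set_subset: "cyclotomic_set q l x \<subseteq> {..q ^ (2 * l) - 1}"
  using exp_rep_le by (auto simp: cyclotomic_set_def)

lemma finite_cyclotomic_set: "finite (cyclotomic_set q l x)"
  using cyclotomic_set_subset finite_subset by blast

lemma self_in_cyclotomic_set:
  assumes "x \<le> q ^ (2 * l) - 1"
  shows "x \<in> cyclotomic_set q l x"
proof -
  have "x = exp_rep q l ((q\<^sup>2) ^ 0 * x)"
    using assms card_a_gt_1 by (cases "x = 0") (simp_all add: exp_rep_def)
  then show ?thesis
    unfolding cyclotomic_set_def by blast
qed

text \<open>By pigeonhole two of the first \<open>n\<^sub>x + 1\<close> Frobenius iterates of a syndrome agree, so all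
  syndromes are roots of some \<open>X^(q^(2d)) - X\<close> with \<open>1 \<le> d \<le> n\<^sub>x\<close>.\<close>

lemma card_range_syndrome:
  "card (range (syndrome \<phi> Y x)) \<le> (q\<^sup>2) ^ card (cyclotomic_set q l x)"
proof -
  let ?n = "card (cyclotomic_set q l x)" and ?f = "\<lambda>i. exp_rep q l ((q\<^sup>2) ^ i * x)"
  have "?f ` {..?n} \<subseteq> cyclotomic_set q l x"
    by (auto simp: cyclotomic_set_def)
  then have "card (?f ` {..?n}) \<le> ?n"
    by (rule card_mono[OF finite_cyclotomic_set])
  then have "card (?f ` {..?n}) < card {..?n}"
    by (simp only: card_atMost less_Suc_eq_le)
  then have "\<not> inj_on ?f {..?n}"
    by (rule pigeonhole)
  then obtain i j where ij: "i < j" "j \<le> ?n" "?f i = ?f j"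
    unfolding inj_on_def by (metis atMost_iff linorder_neqE_nat)
  define d where "d = j - i"
  have j: "j = d + i"
    using ij(1) by (simp add: d_def)
  have "syndrome \<phi> Y x v ^ ((q\<^sup>2) ^ d) = syndrome \<phi> Y x v" for v
  \<comment> \<open>The coincidence of iterates \<open>i\<close> and \<open>j\<close> gives the
    claim only after a further power by \<open>(q ^ 2) ^ i\<close>, which injectivity
    removes.\<close>
  proof (rule Frobenius_inj[OF primepow_q card_a, of _ "2 * i"])
    have "(syndrome \<phi> Y x v ^ ((q\<^sup>2) ^ d)) ^ ((q\<^sup>2) ^ i) = syndrome \<phi> Y x v ^ ((q\<^sup>2) ^ j)"
      unfolding j power_add by (rule power_mult[symmetric])
    also have "\<dots> = syndrome \<phi> Y x v ^ ((q\<^sup>2) ^ i)"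
      by (metis ij(3) syndrome_exp_rep syndrome_power)
    finally show "(syndrome \<phi> Y x v ^ ((q\<^sup>2) ^ d)) ^ (q ^ (2 * i)) = syndrome \<phi> Y x v ^ (q ^ (2 * i))"
      by (simp add: power_mult)
  qed
  then have "card (range (syndrome \<phi> Y x)) \<le> card {s::'a. s ^ ((q\<^sup>2) ^ d) = s}"
    by (intro card_mono) auto
  also have "\<dots> \<le> (q\<^sup>2) ^ d"
    using q_gt_1 ij(1) by (intro card_power_fixed_le one_less_power) (auto simp: d_def)
  also have "\<dots> \<le> (q\<^sup>2) ^ ?n"
    using q_gt_1 ij(2) by (intro power_increasing) (auto simp: d_def)
  finally show ?thesis .
qed

section \<open>Dimensions by counting\<close>

lemma dim_syndromes_ge:
  fixes Y :: "'m::finite \<Rightarrow> 'a"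
  assumes "finite I"
  shows "CARD('m) \<le> vec.dim {v. \<forall>x\<in>a ` I. syndrome \<phi> Y x v = 0}
    + (\<Sum>i\<in>I. card (cyclotomic_set q l (a i)))"
proof -
  let ?V = "{v. \<forall>x\<in>a ` I. syndrome \<phi> Y x v = 0}"
  have "(q\<^sup>2) ^ CARD('m) = CARD('k ^ 'm)"
    by (simp add: card_k)
  also have "\<dots> \<le> card {v. \<forall>i\<in>I. syndrome \<phi> Y (a i) v = 0} *
      (\<Prod>i\<in>I. (q\<^sup>2) ^ card (cyclotomic_set q l (a i)))"
    by (intro CARD_le_card_common_kernel assms syndrome_add card_range_syndrome)
  also have "\<dots> = card ?V * (q\<^sup>2) ^ (\<Sum>i\<in>I. card (cyclotomic_set q l (a i)))"
    by (simp add: power_sum)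
  also have "\<dots> = (q\<^sup>2) ^ (vec.dim ?V + (\<Sum>i\<in>I. card (cyclotomic_set q l (a i))))"
    unfolding card_subspace_vec[OF subspace_syndromes] card_k power_add ..
  finally show ?thesis
    using Q_gt_1 by (simp only: power_increasing_iff)
qed

text \<open>Trace values are fixed by the \<open>q\<close>-th power map, so there are at most
  \<open>q\<close> of them; the kernel of this additive map therefore has at least
  \<open>q ^ (2 * l) / q\<close> elements.\<close>

lemma card_Y_Tr_ge: "q ^ (2 * l - 1) \<le> card (Y_Tr q l :: 'a set)"
proof -
  have Tr_add: "Tr q l (x + y) = Tr q l x + Tr q l y" for x y :: 'a
    using Frobenius_sum[OF primepow_q card_a, of "\<lambda>b. if b then x else y" UNIV]
    by (simp add: Tr_def UNIV_bool sum.distrib add.commute)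
  have Tr_power: "Tr q l x ^ q = Tr q l x" for x :: 'a
  proof -
    \<comment> \<open>Taking the power shifts the exponents by one; adding \<open>x\<close> restores
      the first term, and the last of the \<open>2 * l + 1\<close> terms is again
      \<open>x\<close>.\<close>
    have "Tr q l x ^ q + x = (\<Sum>j<2 * l. x ^ (q ^ Suc j)) + x ^ (q ^ 0)"
      using Frobenius_sum[OF primepow_q card_a, of "\<lambda>j. x ^ (q ^ j)" "{..<2 * l}" 1]
      by (simp add: Tr_def mult.commute flip: power_mult)
    also have "\<dots> = (\<Sum>j<Suc (2 * l). x ^ (q ^ j))"
      by (simp only: sum.lessThan_Suc_shift add.commute)
    also have "\<dots> = Tr q l x + x"
      using finite_field_power_CARD[of x] by (simp add: Tr_def card_a)
    finally show ?thesis
      by simp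
  qed
  have "card (range (Tr q l :: 'a \<Rightarrow> 'a)) \<le> card {s::'a. s ^ q = s}"
    by (intro card_mono) (auto simp: Tr_power)
  also have "\<dots> \<le> q"
    by (rule card_power_fixed_le) (rule q_gt_1)
  finally have range_le: "card (range (Tr q l :: 'a \<Rightarrow> 'a)) \<le> q" .
  have "q ^ (2 * l) \<le> card (Y_Tr q l :: 'a set) * q"
    using CARD_le_card_common_kernel[of "{()}" "\<lambda>_. Tr q l :: 'a \<Rightarrow> 'a" "\<lambda>_. q"] Tr_add range_le
    by (simp add: Y_Tr_def card_a)
  then have "q ^ (2 * l - 1) * q \<le> card (Y_Tr q l :: 'a set) * q"
    using l_ge_1 by (simp add: power_eq_if mult.commute)
  then show ?thesis
    using q_gt_1 by simp
qed

text \<open>Words of \<open>C\<close> with zero at \<open>\<omega>\<close> form a copy of the common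
  kernel, and \<open>c\<close> spans a complement. The resulting bijection compares sizes, hence
  dimensions.\<close>

lemma dim_extended_syndromes:
  fixes Y :: "'m::finite \<Rightarrow> 'a" and \<sigma> :: "'m \<Rightarrow> 'n::finite"
  assumes \<sigma>: "inj \<sigma>" "\<omega> \<notin> range \<sigma>" "UNIV = insert \<omega> (range \<sigma>)"
    and "b \<in> \<Delta>"
    and C_def: "C = {v. (\<forall>x\<in>\<Delta> - {b}. syndrome \<phi> Y x (\<chi> j. v $ \<sigma> j) = 0) \<and>
        syndrome \<phi> Y b (\<chi> j. v $ \<sigma> j) + \<phi> (v $ \<omega>) = 0}"
    and c: "c \<in> C" "c $ \<omega> \<noteq> 0"
  shows "vec.dim C = vec.dim {v. \<forall>x\<in>\<Delta>. syndrome \<phi> Y x v = 0} + 1"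
proof -
  let ?V = "{v. \<forall>x\<in>\<Delta>. syndrome \<phi> Y x v = 0}"
  have restrict_add: "(\<chi> j. (v + w) $ \<sigma> j) = (\<chi> j. v $ \<sigma> j) + (\<chi> j. w $ \<sigma> j)"
    and restrict_scale: "(\<chi> j. (k *s v) $ \<sigma> j) = k *s (\<chi> j. v $ \<sigma> j)"
    and restrict_zero: "(\<chi> j. (0 :: 'k ^ 'n) $ \<sigma> j) = 0" for v w :: "'k ^ 'n" and k
    by (simp_all add: vec_eq_iff)
  define T where "T v = syndrome \<phi> Y b (\<chi> j. v $ \<sigma> j) + \<phi> (v $ \<omega>)" for v
  have T_add: "T (v + w) = T v + T w" and T_scale: "T (k *s v) = \<phi> k * T v"
    and T_zero: "T 0 = 0" for v w k
    unfolding T_def restrict_add restrict_scale restrict_zero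
    using \<phi>_eq_0_iff[of 0]
    by (simp_all add: syndrome_add syndrome_scale syndrome_zero \<phi>_add \<phi>_mult algebra_simps)
  have C_eq: "C = {v. (\<forall>x\<in>\<Delta> - {b}. syndrome \<phi> Y x (\<chi> j. v $ \<sigma> j) = 0) \<and> T v = 0}"
    unfolding C_def T_def ..
  have subspace_C: "vec.subspace C"
    unfolding vec.subspace_def C_eq mem_Collect_eq restrict_add restrict_scale restrict_zero
    by (simp add: syndrome_add syndrome_scale syndrome_zero T_add T_scale T_zero)
  \<comment> \<open>With the entry at \<open>\<omega>\<close> normalised to 1, subtracting
    \<open>(v $ \<omega>) *s u\<close> clears that entry of \<open>v\<close>.\<close>
  define u where "u = inverse (c $ \<omega>) *s c"
  have u: "u \<in> C" "u $ \<omega> = 1"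
    using c subspace_C by (simp_all add: u_def vec.subspace_scale)
  define extend :: "'k ^ 'm \<Rightarrow> 'k ^ 'n"
    where "extend w = (\<chi> i. if i = \<omega> then 0 else w $ inv_into UNIV \<sigma> i)" for w
  define restrict :: "'k ^ 'n \<Rightarrow> 'k ^ 'm" where "restrict v = (\<chi> j. v $ \<sigma> j)" for v
  have restrict_extend: "restrict (extend w) = w" and extend_inf: "extend w $ \<omega> = 0" for w
    using \<sigma>(1,2) by (auto simp: restrict_def extend_def vec_eq_iff)
  have extend_restrict: "extend (restrict v) = v" if "v $ \<omega> = 0" for v
    unfolding vec_eq_iff
  proof
    fix i
    have "i = \<omega> \<or> i \<in> range \<sigma>"
      using \<sigma>(3) by blast
    then show "extend (restrict v) $ i = v $ i"
      using that \<sigma>(1,2) by (auto simp: restrict_def extend_def)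
  qed
  \<comment> \<open>A zero at \<open>\<omega>\<close> turns the mixed check into the plain syndrome
    at \<open>b\<close>, which belongs to the checks of \<open>?V\<close> as
    \<open>b \<in> \<Delta>\<close>.\<close>
  have in_V_iff: "restrict v \<in> ?V \<longleftrightarrow> v \<in> C" if "v $ \<omega> = 0" for v
    using that \<open>b \<in> \<Delta>\<close> \<phi>_eq_0_iff[of 0] by (auto simp: C_def restrict_def)
  have "bij_betw (\<lambda>(s, w). s *s u + extend w) (UNIV \<times> ?V) C"
  proof (rule bij_betw_byWitness[where f' = "\<lambda>v. (v $ \<omega>, restrict (v - (v $ \<omega>) *s u))"])
    show "\<forall>p\<in>UNIV \<times> ?V. (\<lambda>v. (v $ \<omega>, restrict (v - (v $ \<omega>) *s u)))
        ((\<lambda>(s, w). s *s u + extend w) p) = p"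
      by (auto simp: u(2) extend_inf restrict_extend)
    show "\<forall>v\<in>C. (\<lambda>(s, w). s *s u + extend w) (v $ \<omega>, restrict (v - (v $ \<omega>) *s u)) = v"
      by (simp add: u(2) extend_restrict)
    show "(\<lambda>(s, w). s *s u + extend w) ` (UNIV \<times> ?V) \<subseteq> C"
      using in_V_iff[OF extend_inf] u(1) subspace_C
      by (auto simp: restrict_extend intro!: vec.subspace_add vec.subspace_scale)
    show "(\<lambda>v. (v $ \<omega>, restrict (v - (v $ \<omega>) *s u))) ` C \<subseteq> UNIV \<times> ?V"
    proof (rule image_subsetI)
      fix v assume "v \<in> C"
      then have "restrict (v - (v $ \<omega>) *s u) \<in> ?V"
        using u subspace_C
        by (subst in_V_iff) (auto intro!: vec.subspace_diff vec.subspace_scale)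
      then show "(v $ \<omega>, restrict (v - (v $ \<omega>) *s u)) \<in> UNIV \<times> ?V"
        by (intro SigmaI UNIV_I)
    qed
  qed
  then have "card ((UNIV :: 'k set) \<times> ?V) = card C"
    by (rule bij_betw_same_card)
  then have "(q\<^sup>2) ^ vec.dim C = (q\<^sup>2) ^ (vec.dim ?V + 1)"
    by (simp add: card_cartesian_product card_subspace_vec[OF subspace_C]
        card_subspace_vec[OF subspace_syndromes] card_k)
  then show ?thesis
    using Q_gt_1 by (simp only: power_inject_exp)
qed

text \<open>Replaces an arbitrary exponent by a minimal representative that is no larger, so that
  consecutiveness of the \<open>a i\<close> can be applied.\<close>

lemma Min_cyclotomic_set:
  assumes "x \<le> q ^ (2 * l) - 1"
  shows "Min (cyclotomic_set q l x) \<le> x"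
    and "Min (cyclotomic_set q l x) \<in> cyclotomic_set q l x"
    and "Min (cyclotomic_set q l x) \<in> min_representatives q l"
  using self_in_cyclotomic_set[OF assms] finite_cyclotomic_set assms
  by (auto simp: min_representatives_def intro!: Min_in)

end

text \<open>The dimension bound is stated over the integers, where the subtraction is not truncated
  at 0.\<close>

theorem theorem6p4:
  fixes q l t :: nat
    and a :: "nat \<Rightarrow> nat"
    and \<phi> :: "'k::{field, finite} \<Rightarrow> 'a::{field, finite}"
    and P :: "'n::finite \<Rightarrow> 'a \<times> 'a"
    and Y :: "'m::finite \<Rightarrow> 'a"
    and \<Delta> \<Delta>'' :: "nat set"
    and n :: nat
  assumes q: "primepow q" and l: "l \<ge> 1"
    and card_a: "CARD('a) = q ^ (2 * l)" and card_k: "CARD('k) = q\<^sup>2"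
    and \<phi>: "field_embedding \<phi>"
    and P: "bij_betw P UNIV (X_Tr q l)"
    and Y: "bij_betw Y UNIV (Y_Tr q l)"
    and a_0: "a 0 = 0"
    and a_mono: "strict_mono_on {..t} a"
    and a_consec: "a ` {..t} = {x \<in> min_representatives q l. x \<le> a t}"
    and a_t: "a t < q ^ (2 * l) - 1"
    and \<Delta>: "\<Delta> = (\<Union>i<t. cyclotomic_set q l (a i)) \<union> {a t}"
    and \<Delta>'': "\<Delta>'' = \<Delta> \<union> cyclotomic_set q l (a t)"
    and n: "n = q ^ (2 * l - 1) + 1"
    and nondeg: "\<not> degenerate (subfield_subcode \<phi> (dual_code (D_code P \<Delta> (a t))))"
  shows "vec.dim (subfield_subcode \<phi> (dual_code (D_code P \<Delta> (a t))))
           = vec.dim (subfield_subcode \<phi> (dual_code (RS_code Y \<Delta>''))) + 1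
       \<and> int (vec.dim (subfield_subcode \<phi> (dual_code (RS_code Y \<Delta>''))) + 1)
           \<ge> int n - (\<Sum>i\<le>t. int (card (cyclotomic_set q l (a i))))
       \<and> min_dist (subfield_subcode \<phi> (dual_code (D_code P \<Delta> (a t)))) \<ge> a t + 2"
proof -
  interpret finite_field_extension q l \<phi>
    by unfold_locales (fact q l card_a card_k \<phi>)+
  obtain \<sigma> \<omega> where \<sigma>: "inj \<sigma>" "\<omega> \<notin> range \<sigma>" "UNIV = insert \<omega> (range \<sigma>)"
    and P_\<sigma>: "\<And>j. P (\<sigma> j) = (1, Y j)" "P \<omega> = (0, 1)"
    using bij_betw_X_Tr_cases[OF P Y] by metis
  define C where "C = subfield_subcode \<phi> (dual_code (D_code P \<Delta> (a t)))"
  have C_eq: "C = {v. (\<forall>x\<in>\<Delta> - {a t}. syndrome \<phi> Y x (\<chi> j. v $ \<sigma> j) = 0) \<and>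
      syndrome \<phi> Y (a t) (\<chi> j. v $ \<sigma> j) + \<phi> (v $ \<omega>) = 0}"
    unfolding C_def by (rule subfield_subcode_dual_D_code[OF \<sigma> P_\<sigma>])
  have a_less: "a i < a t" if "i < t" for i
    using a_mono that by (auto simp: strict_mono_on_def)
  have a_self: "a i \<in> cyclotomic_set q l (a i)" if "i \<le> t" for i
    using a_less[of i] a_t that by (intro self_in_cyclotomic_set) (cases "i = t", auto)
  \<comment> \<open>The exponents in \<open>\<Delta>''\<close>, in \<open>\<Delta>\<close> and in
    \<open>a\<close> on \<open>{..t}\<close> impose equivalent checks: \<open>\<Delta>\<close> fits
    the codimension argument, the representatives fit the counting.\<close>
  have RS_eq: "subfield_subcode \<phi> (dual_code (RS_code Y \<Delta>'')) = {v. \<forall>x\<in>\<Gamma>. syndrome \<phi> Y x v = 0}"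
    if "\<Gamma> = a ` {..t} \<or> \<Gamma> = \<Delta>" for \<Gamma>
  proof -
    have cover: "\<exists>i\<le>t. x \<in> cyclotomic_set q l (a i)" if "x \<in> \<Delta>''" for x
      using that a_self[of t] by (auto simp: \<Delta>'' \<Delta> le_eq_less_or_eq)
    have "a ` {..t} \<subseteq> \<Delta>"
      using a_self by (auto simp: \<Delta> le_eq_less_or_eq)
    then have \<Gamma>: "a ` {..t} \<subseteq> \<Gamma>" "\<Gamma> \<subseteq> \<Delta>''"
      using that \<Delta>'' by auto
    have "(\<forall>x\<in>\<Delta>''. syndrome \<phi> Y x v = 0) \<longleftrightarrow> (\<forall>x\<in>\<Gamma>. syndrome \<phi> Y x v = 0)" for v
    proof
      assume *: "\<forall>x\<in>\<Gamma>. syndrome \<phi> Y x v = 0"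
      show "\<forall>x\<in>\<Delta>''. syndrome \<phi> Y x v = 0"
      proof
        fix x assume "x \<in> \<Delta>''"
        then obtain i where "i \<le> t" "x \<in> cyclotomic_set q l (a i)"
          using cover by blast
        then show "syndrome \<phi> Y x v = 0"
          using syndrome_cyclotomic_set * \<Gamma>(1) by blast
      qed
    qed (use \<Gamma>(2) in blast)
    then show ?thesis
      by (simp add: subfield_subcode_dual_RS_code)
  qed
  \<comment> \<open>Nondegeneracy is applied at the coordinate \<open>\<omega>\<close>.\<close>
  obtain c where c: "c \<in> C" "c $ \<omega> \<noteq> 0"
    using nondeg by (auto simp: degenerate_def C_def)
  have dim_C: "vec.dim C = vec.dim (subfield_subcode \<phi> (dual_code (RS_code Y \<Delta>''))) + 1"
    using dim_extended_syndromes[OF \<sigma> _ C_eq c] RS_eq[of \<Delta>] by (simp add: \<Delta>)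
  have "q ^ (2 * l - 1) \<le> CARD('m)"
    using card_Y_Tr_ge bij_betw_same_card[OF Y] by simp
  also have "\<dots> \<le> vec.dim (subfield_subcode \<phi> (dual_code (RS_code Y \<Delta>'')))
      + (\<Sum>i\<le>t. card (cyclotomic_set q l (a i)))"
    using dim_syndromes_ge[of "{..t}" a Y] RS_eq[of "a ` {..t}"] by simp
  \<comment> \<open>The summand 1 in \<open>n\<close> matches the extra dimension coming from
    \<open>\<omega>\<close>.\<close>
  finally have dim_ge: "int n - (\<Sum>i\<le>t. int (card (cyclotomic_set q l (a i))))
      \<le> int (vec.dim (subfield_subcode \<phi> (dual_code (RS_code Y \<Delta>''))) + 1)"
    unfolding n of_nat_sum[symmetric] by linarith
  have low: "syndrome \<phi> Y x (\<chi> j. v $ \<sigma> j) = 0" if x: "x < a t" and v: "v \<in> C" for x v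
  proof -
    have x_le: "x \<le> q ^ (2 * l) - 1"
      using x a_t by simp
    let ?z = "Min (cyclotomic_set q l x)"
    note z = Min_cyclotomic_set[OF x_le]
    \<comment> \<open>Consecutiveness enters here: a minimal representative below \<open>a t\<close>
      is one of the \<open>a i\<close>, and then \<open>i < t\<close>.\<close>
    have "?z \<in> a ` {..t}"
      unfolding a_consec using z x by simp
    then obtain i where i: "i \<le> t" "?z = a i"
      by blast
    then have "i < t"
      using z(1) x by (cases "i = t") auto
    then have "a i \<in> \<Delta> - {a t}"
      using a_less[of i] a_self[of i] by (auto simp: \<Delta>)
    then have "syndrome \<phi> Y ?z (\<chi> j. v $ \<sigma> j) = 0"
      using v i(2) by (simp add: C_eq)
    then show ?thesis
      using syndrome_cyclotomic_set[OF z(2)] by blast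
  qed
  \<comment> \<open>The checks are additive, so \<open>v - w\<close> satisfies them, and its weight
    is the distance.\<close>
  have dist: "a t + 2 \<le> hamming_dist v w" if vw: "v \<in> C" "w \<in> C" "v \<noteq> w" for v w
  proof -
    let ?r = "\<lambda>v. \<chi> j. v $ \<sigma> j"
    have diff: "?r (v - w) = ?r v - ?r w"
      by (simp add: vec_eq_iff)
    have "?r (v - w) \<noteq> 0 \<or> (v - w) $ \<omega> \<noteq> 0"
    proof (rule ccontr)
      assume "\<not> ?thesis"
      then have "\<forall>i\<in>insert \<omega> (range \<sigma>). v $ i = w $ i"
        by (auto simp: vec_eq_iff)
      then show False
        using vw(3) \<sigma>(3) by (simp add: vec_eq_iff)
    qed
    then have "a t + 2 \<le> card {j. ?r (v - w) $ j \<noteq> 0} + (if (v - w) $ \<omega> = 0 then 0 else 1)"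
    proof (rule weight_lower_bound[OF _ \<phi>_eq_0_iff, rotated -1])
      show "inj Y"
        using Y by (simp add: bij_betw_def)
      show "syndrome \<phi> Y x (?r (v - w)) = 0" if "x < a t" for x
        unfolding diff syndrome_diff using low that vw by simp
      show "syndrome \<phi> Y (a t) (?r (v - w)) + \<phi> ((v - w) $ \<omega>) = 0"
        unfolding diff syndrome_diff using vw
        by (simp add: C_eq \<phi>_diff) (simp add: add_eq_0_iff)
    qed
    also have "\<dots> = card {i. (v - w) $ i \<noteq> 0}"
      by (rule weight_eq_restrict[OF \<sigma>, symmetric])
    finally show ?thesis
      by (simp add: hamming_dist_def)
  qed
  \<comment> \<open>Together with \<open>c\<close> this gives two distinct words, so the infimum is
    over a nonempty set and not the default 0.\<close>
  have "0 \<in> C"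
    unfolding C_eq using syndrome_zero[of Y] \<phi>_eq_0_iff[of 0] by (simp add: zero_vec_def)
  then have "{hamming_dist v w | v w. v \<in> C \<and> w \<in> C \<and> v \<noteq> w} \<noteq> {}"
    using c by force
  then have "min_dist C \<ge> a t + 2"
    unfolding min_dist_def by (rule cInf_greatest) (use dist in blast)
  then show ?thesis
    using dim_C dim_ge by (simp add: C_def)
qed

end
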